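(* In any transition system $(\mathrm{Proc},\mathsf{Act},\rightarrow,\uparrow)$, for all $p,q\in\mathrm{Proc}$ and every ordinal $\lambda$, \[ p\lesssim_\lambda q\iff \mathcal{L}^{(\mathsf{Act},\lambda)}_\infty(p)\subseteq\mathcal{L}^{(\mathsf{Act},\lambda)}_\infty(q), \] and therefore $p\lesssim^{B}q\iff\mathcal{L}_\infty(p)\subseteq\mathcal{L}_\infty(q)$.
   Context: A transition system is $(\mathrm{Proc},\mathsf{Act},\rightarrow,\uparrow)$ with ${\rightarrow}\subseteq\mathrm{Proc}\times\mathsf{Act}\times\mathrm{Proc}$ (written $p\xrightarrow{a}q$) and ${\uparrow}\subseteq\mathrm{Proc}$; $p\downarrow$ means not $p\uparrow$. Relations $\lesssim_\alpha$: $\lesssim_0=\mathrm{Proc}\times\mathrm{Proc}$; $p\lesssim_{\alpha+1}q$ iff for all $a$: (1) $p\xrightarrow{a}p'$ implies $\exists q'.\,q\xrightarrow{a}q'\wedge p'\lesssim_\alpha q'$; (2) $p\downarrow$ implies $q\downarrow$ and ($q\xrightarrow{a}q'$ implies $\exists p'.\,p\xrightarrow{a}p'\wedge p'\lesssim_\alpha q'$); at limits take intersections. $\lesssim^B$ is the largest prebisimulation, i.e. the union of all relations $R$ satisfying (1),(2) with $R$ in place of $\lesssim_\alpha$ on both sides. The logic $\mathcal{L}_\infty$ has two sorts $\pi,\kappa$: for $\sigma\in\{\pi,\kappa\}$, any set $I$ and formulas $\phi_i$ of sort $\sigma$, $\bigwedge_{i\in I}\phi_i$ and $\bigvee_{i\in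 I}\phi_i$ have sort $\sigma$; if $a\in\mathsf{Act}$ and $\phi$ has sort $\pi$ then $a(\phi)$ has sort $\kappa$; if $\phi$ has sort $\kappa$ then $\Box\phi,\Diamond\phi$ have sort $\pi$. Let $\mathrm{Cap}=\{\bot\}\cup(\mathsf{Act}\times\mathrm{Proc})$ and $C(p)=\{\bot: p\uparrow\}\cup\{\langle a,q\rangle:p\xrightarrow{a}q\}$. Satisfaction (processes for sort $\pi$, capabilities for sort $\kappa$): conjunctions/disjunctions as usual; $p\models\Box\phi$ iff every $c\in C(p)$ satisfies $\phi$; $p\models\Diamond\phi$ iff some $c\in C(p)\cup\{\bot\}$ satisfies $\phi$; $c\models a(\phi)$ iff $c=\langle a,q\rangle$ with $q\models\phi$. Modal depth: $\mathsf{md}$ of a conjunction or disjunction is the sup of the depths of its components, $\mathsf{md}(a(\phi))=\mathsf{md}(\phi)$, $\mathsf{md}(\Box\phi)=\mathsf{md}(\Diamond\phi)=\mathsf{md}(\phi)+1$; $\mathsf{sort}(\phi)$ is the set of actions occurring in $\phi$. $\mathcal{L}_\infty(p)$ is the set of sort-$\pi$ formulas satisfied by $p$, and $\mathcal{L}^{(A,\lambda)}_\infty(p)$ the set of those $\phi\in\mathcal{L}_\infty(p)$ with $\mathsf{sort}(\phi)\subseteq A$ and $\mathsf{md}(\phi)\le\lambda$. *)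

theory Defs
  imports Main
begin

section \<open>Transition systems and prebisimulation\<close>

text \<open>
  The sets of processes and of actions are the types \<open>'p\<close> and \<open>'a\<close>.
\<close>

record ('p, 'a) transition_system =
  trans :: "('p \<times> 'a \<times> 'p) set"
  diverge :: "'p set"

text \<open>Clauses (1) and (2), as an operator on relations.\<close>

definition prebisim_step :: "('p, 'a) transition_system \<Rightarrow> ('p \<times> 'p) set \<Rightarrow> ('p \<times> 'p) set" where
  "prebisim_step T R = {(p, q). \<forall>a.
     (\<forall>p'. (p, a, p') \<in> trans T \<longrightarrow> (\<exists>q'. (q, a, q') \<in> trans T \<and> (p', q') \<in> R)) \<and>
     (p \<notin> diverge T \<longrightarrow>
        q \<notin> diverge T \<and>
        (\<forall>q'. (q, a, q') \<in> trans T \<longrightarrow> (\<exists>p'. (p, a, p') \<in> trans T \<and> (p', q') \<in> R)))}"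

definition prebisimulation :: "('p, 'a) transition_system \<Rightarrow> ('p \<times> 'p) set \<Rightarrow> bool" where
  "prebisimulation T R \<longleftrightarrow> R \<subseteq> prebisim_step T R"

definition prebisimilarity :: "('p, 'a) transition_system \<Rightarrow> ('p \<times> 'p) set" where
  "prebisimilarity T = \<Union> {R. prebisimulation T R}"

text \<open>
  Ordinals are the elements of an arbitrary type \<open>'o\<close> of class \<open>wellorder\<close>, an element
  standing for the order type of the set of its predecessors. Every ordinal arises in this way
  for a suitable choice of \<open>'o\<close>.
\<close>

definition is_zero :: "'o::wellorder \<Rightarrow> bool" where
  "is_zero \<alpha> \<longleftrightarrow> (\<forall>\<beta>. \<alpha> \<le> \<beta>)"

definition is_suc :: "'o::wellorder \<Rightarrow> 'o \<Rightarrow> bool" where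
  "is_suc \<alpha> \<beta> \<longleftrightarrow> \<alpha> < \<beta> \<and> (\<forall>\<gamma>. \<alpha> < \<gamma> \<longrightarrow> \<beta> \<le> \<gamma>)"

lemma is_suc_unique: "is_suc \<alpha> \<beta> \<Longrightarrow> is_suc \<alpha>' \<beta> \<Longrightarrow> \<alpha> = \<alpha>'"
  by (meson is_suc_def leD not_less_iff_gr_or_eq)

lemma the_pred: "is_suc \<alpha> \<beta> \<Longrightarrow> (THE \<gamma>. is_suc \<gamma> \<beta>) = \<alpha>"
  using is_suc_unique by blast

function approx :: "('p, 'a) transition_system \<Rightarrow> 'o::wellorder \<Rightarrow> ('p \<times> 'p) set" where
  "approx T \<alpha> =
     (if is_zero \<alpha> then UNIV
      else if \<exists>\<beta>. is_suc \<beta> \<alpha> then prebisim_step T (approx T (THE \<beta>. is_suc \<beta> \<alpha>))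
      else (\<Inter>\<beta>\<in>{..<\<alpha>}. approx T \<beta>))"
  by pat_completeness auto
termination
proof (relation "inv_image {(\<alpha>, \<beta>). \<alpha> < \<beta>} snd", goal_cases)
  case 1
  show ?case
    by (rule wf_inv_image) (rule wf)
qed (auto simp: the_pred, auto simp: is_suc_def)

declare approx.simps [simp del]

lemma approx_zero: "is_zero \<alpha> \<Longrightarrow> approx T \<alpha> = UNIV"
  by (simp add: approx.simps)

lemma approx_suc: "is_suc \<beta> \<alpha> \<Longrightarrow> approx T \<alpha> = prebisim_step T (approx T \<beta>)"
proof -
  assume suc: "is_suc \<beta> \<alpha>"
  then have "\<not> is_zero \<alpha>"
    by (auto simp: is_zero_def is_suc_def not_le)
  with suc show ?thesis
    by (subst approx.simps) (auto simp: the_pred)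
qed

lemma approx_limit:
  "\<not> is_zero \<alpha> \<Longrightarrow> \<nexists>\<beta>. is_suc \<beta> \<alpha> \<Longrightarrow> approx T \<alpha> = (\<Inter>\<beta>\<in>{..<\<alpha>}. approx T \<beta>)"
  by (subst approx.simps) simp

section \<open>The infinitary logic\<close>

text \<open>
  A family of formulas is a partial function on the type \<open>'i\<close>; its index set \<open>I\<close> is the domain
  and its members are the range \<open>ran\<close>. In particular the empty conjunction and the empty
  disjunction are \<open>PConj Map.empty\<close> and \<open>PDisj Map.empty\<close>.

  Arbitrary index sets would make the formulas a proper class, so the index sets are the subsets
  of an arbitrary type \<open>'i\<close>. The logic is expressive enough only if \<open>'i\<close> is not too small, for
  instance if \<open>'a \<times> 'p\<close> embeds into it; no upper bound on its size is needed.
\<close>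

datatype
  ('a, 'i) pform =
    PConj "'i \<Rightarrow> ('a, 'i) pform option"
  | PDisj "'i \<Rightarrow> ('a, 'i) pform option"
  | Box "('a, 'i) kform"
  | Dia "('a, 'i) kform"
and
  ('a, 'i) kform =
    KConj "'i \<Rightarrow> ('a, 'i) kform option"
  | KDisj "'i \<Rightarrow> ('a, 'i) kform option"
  | Act 'a "('a, 'i) pform"

lemma ran_map_option: "ran (\<lambda>i. map_option g (\<phi> i)) = g ` ran \<phi>"
  by (auto simp: ran_def)

datatype ('p, 'a) cap = Bot | Cap 'a 'p

definition caps :: "('p, 'a) transition_system \<Rightarrow> 'p \<Rightarrow> ('p, 'a) cap set" where
  "caps T p = (if p \<in> diverge T then {Bot} else {}) \<union> {Cap a q |a q. (p, a, q) \<in> trans T}"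

primrec
  psat :: "('p, 'a) transition_system \<Rightarrow> ('a, 'i) pform \<Rightarrow> 'p \<Rightarrow> bool" and
  ksat :: "('p, 'a) transition_system \<Rightarrow> ('a, 'i) kform \<Rightarrow> ('p, 'a) cap \<Rightarrow> bool"
where
  "psat T (PConj \<phi>) = (\<lambda>x. \<forall>P\<in>ran (\<lambda>i. map_option (psat T) (\<phi> i)). P x)"
| "psat T (PDisj \<phi>) = (\<lambda>x. \<exists>P\<in>ran (\<lambda>i. map_option (psat T) (\<phi> i)). P x)"
| "psat T (Box \<psi>) = (\<lambda>p. \<forall>c\<in>caps T p. ksat T \<psi> c)"
| "psat T (Dia \<psi>) = (\<lambda>p. \<exists>c\<in>caps T p \<union> {Bot}. ksat T \<psi> c)"
| "ksat T (KConj \<psi>) = (\<lambda>x. \<forall>P\<in>ran (\<lambda>i. map_option (ksat T) (\<psi> i)). P x)"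
| "ksat T (KDisj \<psi>) = (\<lambda>x. \<exists>P\<in>ran (\<lambda>i. map_option (ksat T) (\<psi> i)). P x)"
| "ksat T (Act a \<phi>) = (\<lambda>c. \<exists>q. c = Cap a q \<and> psat T \<phi> q)"

lemma sat_conj_disj:
  "psat T (PConj \<phi>) p \<longleftrightarrow> (\<forall>f\<in>ran \<phi>. psat T f p)"
  "psat T (PDisj \<phi>) p \<longleftrightarrow> (\<exists>f\<in>ran \<phi>. psat T f p)"
  "ksat T (KConj \<psi>) c \<longleftrightarrow> (\<forall>g\<in>ran \<psi>. ksat T g c)"
  "ksat T (KDisj \<psi>) c \<longleftrightarrow> (\<exists>g\<in>ran \<psi>. ksat T g c)"
  by (simp_all add: ran_map_option)

primrec
  psort :: "('a, 'i) pform \<Rightarrow> 'a set" and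
  ksort :: "('a, 'i) kform \<Rightarrow> 'a set"
where
  "psort (PConj \<phi>) = \<Union> (ran (\<lambda>i. map_option psort (\<phi> i)))"
| "psort (PDisj \<phi>) = \<Union> (ran (\<lambda>i. map_option psort (\<phi> i)))"
| "psort (Box \<psi>) = ksort \<psi>"
| "psort (Dia \<psi>) = ksort \<psi>"
| "ksort (KConj \<psi>) = \<Union> (ran (\<lambda>i. map_option ksort (\<psi> i)))"
| "ksort (KDisj \<psi>) = \<Union> (ran (\<lambda>i. map_option ksort (\<psi> i)))"
| "ksort (Act a \<phi>) = insert a (psort \<phi>)"

lemma sort_conj_disj:
  "psort (PConj \<phi>) = (\<Union>f\<in>ran \<phi>. psort f)"
  "psort (PDisj \<phi>) = (\<Union>f\<in>ran \<phi>. psort f)"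
  "ksort (KConj \<psi>) = (\<Union>g\<in>ran \<psi>. ksort g)"
  "ksort (KDisj \<psi>) = (\<Union>g\<in>ran \<psi>. ksort g)"
  by (simp_all add: ran_map_option)

section \<open>Modal depth\<close>

text \<open>
  A well-order \<open>'o\<close> need not contain the successors and suprema occurring in the depth of a
  formula, so depths take values in \<open>'o\<close> extended by a top element \<open>Beyond\<close>, which collects
  the ordinals exceeding all elements of \<open>'o\<close>. This does not affect whether a depth is at most
  some \<open>\<lambda> :: 'o\<close>.
\<close>

datatype 'o depth = Ord 'o | Beyond

instantiation depth :: (wellorder) wellorder
begin

definition less_eq_depth :: "'a depth \<Rightarrow> 'a depth \<Rightarrow> bool" where
  "x \<le> y \<longleftrightarrow> (case y of Beyond \<Rightarrow> True | Ord \<beta> \<Rightarrow> (case x of Beyond \<Rightarrow> False | Ord \<alpha> \<Rightarrow> \<alpha> \<le> \<beta>))"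

definition less_depth :: "'a depth \<Rightarrow> 'a depth \<Rightarrow> bool" where
  "x < y \<longleftrightarrow> (case x of Beyond \<Rightarrow> False | Ord \<alpha> \<Rightarrow> (case y of Beyond \<Rightarrow> True | Ord \<beta> \<Rightarrow> \<alpha> < \<beta>))"

instance
proof
  fix P :: "'a depth \<Rightarrow> bool" and x
  assume step: "\<And>x. (\<And>y. y < x \<Longrightarrow> P y) \<Longrightarrow> P x"
  have ord: "P (Ord \<alpha>)" for \<alpha>
  proof (induction \<alpha> rule: less_induct)
    case (less \<alpha>)
    show ?case
      by (rule step) (auto simp: less_depth_def less split: depth.splits)
  qed
  have "P Beyond"
    by (rule step) (auto simp: less_depth_def ord split: depth.splits)
  with ord show "P x"
    by (cases x) auto
qed (auto simp: less_eq_depth_def less_depth_def split: depth.splits)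

end

definition depth_suc :: "'o::wellorder depth \<Rightarrow> 'o depth" where
  "depth_suc x = (if \<exists>y. x < y then LEAST y. x < y else Beyond)"

definition depth_sup :: "'o::wellorder depth set \<Rightarrow> 'o depth" where
  "depth_sup X = (LEAST u. \<forall>x\<in>X. x \<le> u)"

lemma depth_sup_le_iff: "depth_sup X \<le> u \<longleftrightarrow> (\<forall>x\<in>X. x \<le> u)"
proof -
  have "\<forall>x\<in>X. x \<le> (Beyond :: 'a depth)"
    by (simp add: less_eq_depth_def)
  then have "\<forall>x\<in>X. x \<le> depth_sup X"
    unfolding depth_sup_def by (rule LeastI)
  moreover have "depth_sup X \<le> u" if "\<forall>x\<in>X. x \<le> u"
    unfolding depth_sup_def using that by (rule Least_le)
  ultimately show ?thesis
    by (meson order_trans)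
qed

lemma depth_suc_le_Ord_iff: "depth_suc x \<le> Ord \<alpha> \<longleftrightarrow> x < Ord \<alpha>"
proof
  assume "x < Ord \<alpha>"
  then show "depth_suc x \<le> Ord \<alpha>"
    unfolding depth_suc_def by (auto intro: Least_le)
next
  assume le: "depth_suc x \<le> Ord \<alpha>"
  then have ex: "\<exists>y. x < y"
    by (auto simp: depth_suc_def less_eq_depth_def split: if_splits)
  then have "x < depth_suc x"
    unfolding depth_suc_def by (auto intro: LeastI_ex)
  with le show "x < Ord \<alpha>"
    by simp
qed

primrec
  pmd :: "('a, 'i) pform \<Rightarrow> 'o::wellorder depth" and
  kmd :: "('a, 'i) kform \<Rightarrow> 'o::wellorder depth"
where
  "pmd (PConj \<phi>) = depth_sup (ran (\<lambda>i. map_option pmd (\<phi> i)))"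
| "pmd (PDisj \<phi>) = depth_sup (ran (\<lambda>i. map_option pmd (\<phi> i)))"
| "pmd (Box \<psi>) = depth_suc (kmd \<psi>)"
| "pmd (Dia \<psi>) = depth_suc (kmd \<psi>)"
| "kmd (KConj \<psi>) = depth_sup (ran (\<lambda>i. map_option kmd (\<psi> i)))"
| "kmd (KDisj \<psi>) = depth_sup (ran (\<lambda>i. map_option kmd (\<psi> i)))"
| "kmd (Act a \<phi>) = pmd \<phi>"

lemma md_conj_disj:
  "pmd (PConj \<phi>) = depth_sup (pmd ` ran \<phi>)"
  "pmd (PDisj \<phi>) = depth_sup (pmd ` ran \<phi>)"
  "kmd (KConj \<psi>) = depth_sup (kmd ` ran \<psi>)"
  "kmd (KDisj \<psi>) = depth_sup (kmd ` ran \<psi>)"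
  by (simp_all add: ran_map_option)

section \<open>Theories of processes\<close>

definition theory_of :: "('p, 'a) transition_system \<Rightarrow> 'p \<Rightarrow> ('a, 'i) pform set" where
  "theory_of T p = {\<phi>. psat T \<phi> p}"

definition theory_upto ::
  "('p, 'a) transition_system \<Rightarrow> 'a set \<Rightarrow> 'o::wellorder \<Rightarrow> 'p \<Rightarrow> ('a, 'i) pform set" where
  "theory_upto T A \<alpha> p = {\<phi> \<in> theory_of T p. psort \<phi> \<subseteq> A \<and> pmd \<phi> \<le> Ord \<alpha>}"

end

theory Submission
  imports Defs
begin

text \<open>
  Ordered by \<open>\<bottom> \<le> c\<close> and \<open>\<langle>a, p\<rangle> \<le> \<langle>a, q\<rangle>\<close> for \<open>(p, q) \<in> R\<close>, the capabilities turn clauses (1) and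
  (2) into the lower and the upper half of a powerdomain ordering, which \<open>\<diamond>\<close> and \<open>\<box>\<close> express.
  Hence satisfaction is preserved along \<open>R\<close> by induction on formulas. Conversely, if the pairs
  outside \<open>R\<close> are distinguished by formulas of some class, then a violation of (1) at a transition
  \<open>p \<rightarrow> p'\<close> by \<open>a\<close> is witnessed by \<open>\<diamond> a(\<And> \<phi>)\<close>, where the \<open>\<phi>\<close> separate \<open>p'\<close> from the \<open>a\<close>-successors
  of \<open>q\<close>, and a violation of (2) at a capability \<open>d\<close> of \<open>q\<close> is witnessed by \<open>\<box> \<Or> b(\<phi>)\<close>, with one
  disjunct for each capability of \<open>p\<close>, false at \<open>d\<close>.
\<close>

section \<open>The ordering of capabilities and the approximants\<close>

inductive cap_le :: "('p \<times> 'p) set \<Rightarrow> ('p, 'a) cap \<Rightarrow> ('p, 'a) cap \<Rightarrow> bool" for R where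
  cap_le_Bot: "cap_le R Bot c"
| cap_le_Cap: "(p, q) \<in> R \<Longrightarrow> cap_le R (Cap a p) (Cap a q)"

lemma Cap_in_caps [simp]: "Cap a q \<in> caps T p \<longleftrightarrow> (p, a, q) \<in> trans T"
  by (auto simp: caps_def)

lemma Bot_in_caps [simp]: "Bot \<in> caps T p \<longleftrightarrow> p \<in> diverge T"
  by (auto simp: caps_def)

lemma cap_le_simps [simp]:
  "cap_le R Bot c"
  "cap_le R c Bot \<longleftrightarrow> c = Bot"
  "cap_le R (Cap a p) (Cap b q) \<longleftrightarrow> a = b \<and> (p, q) \<in> R"
  by (auto intro: cap_le.intros elim: cap_le.cases)

lemma all_cap: "(\<forall>c. P c) \<longleftrightarrow> P Bot \<and> (\<forall>a p. P (Cap a p))"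
  by (metis cap.exhaust)

lemma ex_cap: "(\<exists>c. P c) \<longleftrightarrow> P Bot \<or> (\<exists>a p. P (Cap a p))"
  by (metis cap.exhaust)

text \<open>\<open>Bot\<close> carries the convergence condition of (2). If \<open>p\<close>
  diverges, its capability \<open>Bot\<close> lies below every \<open>d\<close> and the second
  conjunct is trivial; if \<open>p\<close> converges, nothing in \<open>caps T p\<close> lies below
  \<open>Bot\<close>, so \<open>q\<close> must converge too.\<close>

lemma prebisim_step_iff_caps:
  "(p, q) \<in> prebisim_step T R \<longleftrightarrow>
     (\<forall>c\<in>caps T p. \<exists>d\<in>caps T q \<union> {Bot}. cap_le R c d) \<and>
     (\<forall>d\<in>caps T q. \<exists>c\<in>caps T p. cap_le R c d)"
  unfolding prebisim_step_def Ball_def Bex_def all_cap ex_cap by auto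

lemma prebisim_step_mono: "R \<subseteq> S \<Longrightarrow> prebisim_step T R \<subseteq> prebisim_step T S"
  unfolding prebisim_step_def by blast

text \<open>One equation for zero, successor and limit, so that later inductions need no case
  distinction. At a successor the approximants decrease and the last term is the whole intersection;
  at a limit nested intersections collapse.\<close>

lemma approx_eq_Inter_step: "approx T \<alpha> = (\<Inter>\<beta>\<in>{..<\<alpha>}. prebisim_step T (approx T \<beta>))"
proof (induction \<alpha> rule: less_induct)
  case (less \<alpha>)
  consider "is_zero \<alpha>" | \<beta> where "is_suc \<beta> \<alpha>" | "\<not> is_zero \<alpha>" "\<nexists>\<beta>. is_suc \<beta> \<alpha>"
    by blast
  then show ?case
  proof cases
    case 1
    then have "{..<\<alpha>} = {}"
      by (auto simp: is_zero_def dest: leD)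
    with 1 show ?thesis
      by (simp add: approx_zero)
  next
    case (2 \<beta>)
    \<comment> \<open>By the induction hypothesis both sides are intersections of one family, over
      nested initial segments.\<close>
    have "approx T \<beta> \<subseteq> approx T \<gamma>" if "\<gamma> \<le> \<beta>" for \<gamma>
    proof -
      have "\<gamma> < \<alpha>" "\<beta> < \<alpha>"
        using 2 that by (auto simp: is_suc_def)
      with that show ?thesis
        unfolding less[OF \<open>\<gamma> < \<alpha>\<close>] less[OF \<open>\<beta> < \<alpha>\<close>] by (intro INF_superset_mono) auto
    qed
    then have "prebisim_step T (approx T \<beta>) \<subseteq> prebisim_step T (approx T \<gamma>)" if "\<gamma> \<le> \<beta>" for \<gamma>
      using that by (simp add: prebisim_step_mono)
    moreover have "{..<\<alpha>} = {..\<beta>}"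
      using 2 by (auto simp: is_suc_def not_less[symmetric])
    ultimately show ?thesis
      using 2 by (auto simp: approx_suc)
  next
    case 3
    \<comment> \<open>Without a predecessor of \<alpha>, the ordinals below \<alpha> have no
      greatest element.\<close>
    have "\<exists>\<beta><\<alpha>. \<gamma> < \<beta>" if "\<gamma> < \<alpha>" for \<gamma>
      using 3(2) that unfolding is_suc_def by (meson not_less)
    then have Un: "(\<Union>\<beta>\<in>{..<\<alpha>}. {..<\<beta>}) = {..<\<alpha>}"
      using less_trans by blast
    have "approx T \<alpha> = (\<Inter>\<beta>\<in>{..<\<alpha>}. \<Inter>\<gamma>\<in>{..<\<beta>}. prebisim_step T (approx T \<gamma>))"
      unfolding approx_limit[OF 3] by (rule INF_cong[OF refl], rule less) simp
    also have "\<dots> = (\<Inter>\<gamma>\<in>(\<Union>\<beta>\<in>{..<\<alpha>}. {..<\<beta>}). prebisim_step T (approx T \<gamma>))"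
      by blast
    finally show ?thesis
      unfolding Un .
  qed
qed

lemma approx_subset_step: "\<beta> < \<alpha> \<Longrightarrow> approx T \<alpha> \<subseteq> prebisim_step T (approx T \<beta>)"
  by (subst approx_eq_Inter_step) blast

lemma prebisimilarity_subset_step: "prebisimilarity T \<subseteq> prebisim_step T (prebisimilarity T)"
proof
  fix x
  assume "x \<in> prebisimilarity T"
  then obtain R where R: "R \<subseteq> prebisim_step T R" "x \<in> R"
    by (auto simp: prebisimilarity_def prebisimulation_def)
  then have "R \<subseteq> prebisimilarity T"
    by (auto simp: prebisimilarity_def prebisimulation_def)
  with R show "x \<in> prebisim_step T (prebisimilarity T)"
    using prebisim_step_mono by blast
qed

section \<open>Preservation of satisfaction\<close>

lemma modal_step:
  assumes "(p, q) \<in> prebisim_step T R"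
    and "\<And>c d. cap_le R c d \<Longrightarrow> ksat T \<psi> c \<Longrightarrow> ksat T \<psi> d"
  shows "psat T (Box \<psi>) p \<Longrightarrow> psat T (Box \<psi>) q"
    and "psat T (Dia \<psi>) p \<Longrightarrow> psat T (Dia \<psi>) q"
proof -
  show "psat T (Box \<psi>) p \<Longrightarrow> psat T (Box \<psi>) q"
    using assms unfolding prebisim_step_iff_caps psat.simps by blast
  assume "psat T (Dia \<psi>) p"
  then obtain c where c: "c \<in> caps T p \<union> {Bot}" "ksat T \<psi> c"
    by auto
  then obtain d where "d \<in> caps T q \<union> {Bot}" "cap_le R c d"
    using assms(1) unfolding prebisim_step_iff_caps by fastforce
  with c assms(2) show "psat T (Dia \<psi>) q"
    unfolding psat.simps by blast
qed

lemma less_OrdE: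
  assumes "x < Ord \<alpha>"
  obtains \<beta> where "x = Ord \<beta>" "\<beta> < \<alpha>"
  using assms by (cases x) (auto simp: less_depth_def)

text \<open>The ordinal is generalised because a modality lowers it: its argument has depth \<beta>
  < \<alpha>, and related processes at \<alpha> satisfy the clauses relative to the approximant at
  \<beta>. \<open>Act\<close> and the infinitary connectives keep \<alpha>.\<close>

lemma psat_approx:
  fixes \<phi> :: "('a, 'i) pform" and \<psi> :: "('a, 'i) kform" and \<alpha> :: "'o::wellorder"
  shows "(p, q) \<in> approx T \<alpha> \<Longrightarrow> pmd \<phi> \<le> Ord \<alpha> \<Longrightarrow> psat T \<phi> p \<Longrightarrow> psat T \<phi> q"
    and "cap_le (approx T \<alpha>) c d \<Longrightarrow> kmd \<psi> \<le> Ord \<alpha> \<Longrightarrow> ksat T \<psi> c \<Longrightarrow> ksat T \<psi> d"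
proof (induction \<phi> and \<psi> arbitrary: p q \<alpha> and c d \<alpha>)
  case (PConj \<Phi>)
  then show ?case
    unfolding sat_conj_disj md_conj_disj depth_sup_le_iff ran_def by (simp, blast)
next
  case (PDisj \<Phi>)
  then show ?case
    unfolding sat_conj_disj md_conj_disj depth_sup_le_iff ran_def by (simp, blast)
next
  case (Box \<psi>)
  then obtain \<beta> where "kmd \<psi> = Ord \<beta>" "\<beta> < \<alpha>"
    by (auto simp: depth_suc_le_Ord_iff elim: less_OrdE)
  with Box approx_subset_step[of \<beta> \<alpha> T] show ?case
    by (intro modal_step(1)[of p q T "approx T \<beta>"]) auto
next
  case (Dia \<psi>)
  then obtain \<beta> where "kmd \<psi> = Ord \<beta>" "\<beta> < \<alpha>"
    by (auto simp: depth_suc_le_Ord_iff elim: less_OrdE)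
  with Dia approx_subset_step[of \<beta> \<alpha> T] show ?case
    by (intro modal_step(2)[of p q T "approx T \<beta>"]) auto
next
  case (KConj \<Psi>)
  then show ?case
    unfolding sat_conj_disj md_conj_disj depth_sup_le_iff ran_def by (simp, blast)
next
  case (KDisj \<Psi>)
  then show ?case
    unfolding sat_conj_disj md_conj_disj depth_sup_le_iff ran_def by (simp, blast)
next
  case (Act a \<phi>)
  then show ?case
    by (auto elim!: cap_le.cases)
qed

text \<open>Prebisimilarity lies inside its own step, so the modal cases keep the same relation and
  depth needs no tracking.\<close>

lemma psat_prebisimilarity:
  fixes \<phi> :: "('a, 'i) pform" and \<psi> :: "('a, 'i) kform"
  shows "(p, q) \<in> prebisimilarity T \<Longrightarrow> psat T \<phi> p \<Longrightarrow> psat T \<phi> q"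
    and "cap_le (prebisimilarity T) c d \<Longrightarrow> ksat T \<psi> c \<Longrightarrow> ksat T \<psi> d"
proof (induction \<phi> and \<psi> arbitrary: p q and c d)
  case (PConj \<Phi>)
  then show ?case
    unfolding sat_conj_disj ran_def by (simp, blast)
next
  case (PDisj \<Phi>)
  then show ?case
    unfolding sat_conj_disj ran_def by (simp, blast)
next
  case (Box \<psi>)
  with prebisimilarity_subset_step[of T] show ?case
    by (intro modal_step(1)[of p q T "prebisimilarity T"]) auto
next
  case (Dia \<psi>)
  with prebisimilarity_subset_step[of T] show ?case
    by (intro modal_step(2)[of p q T "prebisimilarity T"]) auto
next
  case (KConj \<Psi>)
  then show ?case
    unfolding sat_conj_disj ran_def by (simp, blast)
next
  case (KDisj \<Psi>)
  then show ?case
    unfolding sat_conj_disj ran_def by (simp, blast)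
next
  case (Act a \<phi>)
  then show ?case
    by (auto elim!: cap_le.cases)
qed

section \<open>Distinguishing formulas\<close>

lemma ex_family:
  fixes e :: "'b \<Rightarrow> 'i" and S :: "'b set"
  assumes "inj e"
  obtains \<Phi> :: "'i \<Rightarrow> 'c option" where "ran \<Phi> = f ` S"
proof (rule that)
  \<comment> \<open>An element of \<open>S\<close> is indexed by its image under \<open>e\<close>,
    and \<open>inv e\<close> recovers it.\<close>
  have "ran (\<lambda>i. if i \<in> e ` S then Some (f (inv e i)) else None) = (f \<circ> inv e) ` e ` S"
    by (auto simp: ran_def)
  then show "ran (\<lambda>i. if i \<in> e ` S then Some (f (inv e i)) else None) = f ` S"
    using assms by (simp add: image_image)
qed

text \<open>
  \<open>P\<close> and \<open>Q\<close> are classes of formulas of the two sorts: all formulas, or those of bounded depth.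
\<close>

lemma ex_modal_distinguishing:
  fixes emb :: "'a \<times> 'p \<Rightarrow> 'i" and T :: "('p, 'a) transition_system"
    and P :: "('a, 'i) pform set" and Q :: "('a, 'i) kform set"
  assumes inj: "inj emb"
    and PConj: "\<And>\<Phi>. ran \<Phi> \<subseteq> P \<Longrightarrow> PConj \<Phi> \<in> P"
    and Act: "\<And>a \<phi>. \<phi> \<in> P \<Longrightarrow> Act a \<phi> \<in> Q"
    and KDisj: "\<And>\<Psi>. ran \<Psi> \<subseteq> Q \<Longrightarrow> KDisj \<Psi> \<in> Q"
    and dist: "\<And>p q. (p, q) \<notin> R \<Longrightarrow> \<exists>\<phi>\<in>P. psat T \<phi> p \<and> \<not> psat T \<phi> q"
    and pq: "(p, q) \<notin> prebisim_step T R"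
  shows "\<exists>\<psi>\<in>Q. \<exists>\<phi>\<in>{Box \<psi>, Dia \<psi>}. psat T \<phi> p \<and> \<not> psat T \<phi> q"
proof -
  consider
      (lower) c where "c \<in> caps T p" "\<forall>d\<in>caps T q \<union> {Bot}. \<not> cap_le R c d"
    | (upper) d where "d \<in> caps T q" "\<forall>c\<in>caps T p. \<not> cap_le R c d"
    using pq unfolding prebisim_step_iff_caps by blast
  then show ?thesis
  proof cases
    case lower
    \<comment> \<open>\<open>c\<close> cannot be \<open>Bot\<close>, since \<open>Bot\<close> is
      always available on the side of \<open>q\<close>.\<close>
    then obtain a p' where c: "c = Cap a p'"
      by (cases c) auto
    with lower have p': "(p, a, p') \<in> trans T"
      by auto
    have "(p', q') \<notin> R" if "(q, a, q') \<in> trans T" for q'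
      using lower(2)[rule_format, of "Cap a q'"] that c by auto
    then have "\<forall>q'. (q, a, q') \<in> trans T \<longrightarrow> (\<exists>\<phi>. \<phi> \<in> P \<and> psat T \<phi> p' \<and> \<not> psat T \<phi> q')"
      using dist by blast
    then obtain \<chi> where \<chi>: "\<And>q'. (q, a, q') \<in> trans T \<Longrightarrow>
        \<chi> q' \<in> P \<and> psat T (\<chi> q') p' \<and> \<not> psat T (\<chi> q') q'"
      by metis
    \<comment> \<open>The action is fixed here, so a slice of \<open>emb\<close> indexes the
      successors of \<open>q\<close>.\<close>
    have "inj (\<lambda>q'. emb (a, q'))"
      using inj by (simp add: inj_def)
    then obtain \<Phi> :: "'i \<Rightarrow> _" where \<Phi>: "ran \<Phi> = \<chi> ` {q'. (q, a, q') \<in> trans T}"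
      by (rule ex_family)
    have "Act a (PConj \<Phi>) \<in> Q"
      by (intro Act PConj) (use \<Phi> \<chi> in auto)
    moreover have "psat T (PConj \<Phi>) p'"
      and "\<And>q'. (q, a, q') \<in> trans T \<Longrightarrow> \<not> psat T (PConj \<Phi>) q'"
      unfolding sat_conj_disj \<Phi> using \<chi> by auto
    then have "psat T (Dia (Act a (PConj \<Phi>))) p" "\<not> psat T (Dia (Act a (PConj \<Phi>))) q"
      using p' by (auto simp del: psat.simps(1))
    ultimately show ?thesis
      by blast
  next
    case upper
    have "\<exists>\<phi>. \<phi> \<in> P \<and> psat T \<phi> p' \<and> \<not> ksat T (Act b \<phi>) d" if "(p, b, p') \<in> trans T" for b p'
    proof (cases "\<exists>q'. d = Cap b q'")
      case True
      then obtain q' where d: "d = Cap b q'" ..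
      have "\<not> cap_le R (Cap b p') d"
        using upper(2) that by simp
      with d have "(p', q') \<notin> R"
        by simp
      from dist[OF this] d show ?thesis
        by auto
    next
      case False
      \<comment> \<open>\<open>d\<close> is \<open>Bot\<close> or carries another action, so
        \<open>Act b\<close> fails at \<open>d\<close> for any argument; the empty conjunction, true
        everywhere, serves.\<close>
      have "PConj Map.empty \<in> P"
        by (rule PConj) simp
      with False show ?thesis
        by (intro exI[of _ "PConj Map.empty"]) auto
    qed
    then obtain \<chi> where \<chi>: "\<And>b p'. (p, b, p') \<in> trans T \<Longrightarrow>
        \<chi> b p' \<in> P \<and> psat T (\<chi> b p') p' \<and> \<not> ksat T (Act b (\<chi> b p')) d"
      by metis
    obtain \<Psi> :: "'i \<Rightarrow> _" where \<Psi>: "ran \<Psi> = (\<lambda>(b, p'). Act b (\<chi> b p')) ` {(b, p'). (p, b, p') \<in> trans T}"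
      using ex_family[OF inj] .
    have "KDisj \<Psi> \<in> Q"
      by (rule KDisj) (use \<Psi> \<chi> Act in auto)
    moreover have "ksat T (KDisj \<Psi>) c" if "c \<in> caps T p" for c
    proof (cases c)
      \<comment> \<open>Impossible: \<open>Bot\<close> would lie below \<open>d\<close>.\<close>
      case Bot
      with upper(2) that show ?thesis
        by (metis cap_le_Bot)
    next
      case (Cap b p')
      with that have "(p, b, p') \<in> trans T"
        by simp
      then have "Act b (\<chi> b p') \<in> ran \<Psi>" "ksat T (Act b (\<chi> b p')) c"
        using \<chi>[of b p'] Cap unfolding \<Psi> by force+
      then show ?thesis
        unfolding sat_conj_disj by (rule bexI[rotated])
    qed
    moreover have "\<not> ksat T (KDisj \<Psi>) d"
      unfolding sat_conj_disj \<Psi> using \<chi> by fast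
    ultimately have "KDisj \<Psi> \<in> Q" "psat T (Box (KDisj \<Psi>)) p" "\<not> psat T (Box (KDisj \<Psi>)) q"
      using \<open>d \<in> caps T q\<close> unfolding psat.simps by blast+
    then show ?thesis
      by blast
  qed
qed

lemma approx_complete:
  fixes T :: "('p, 'a) transition_system" and emb :: "'a \<times> 'p \<Rightarrow> 'i" and \<alpha> :: "'o::wellorder"
  assumes inj: "inj emb"
  shows "(p, q) \<notin> approx T \<alpha> \<Longrightarrow>
    \<exists>\<phi> :: ('a, 'i) pform. pmd \<phi> \<le> Ord \<alpha> \<and> psat T \<phi> p \<and> \<not> psat T \<phi> q"
proof (induction \<alpha> arbitrary: p q rule: less_induct)
  case (less \<alpha>)
  then obtain \<beta> where \<beta>: "\<beta> < \<alpha>" "(p, q) \<notin> prebisim_step T (approx T \<beta>)"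
    by (subst (asm) approx_eq_Inter_step) auto
  \<comment> \<open>Both classes may use the same bound \<beta>, as \<open>Act\<close> and the
    infinitary connectives do not raise depth; the single outer modality then gives depth at most
    \<alpha>.\<close>
  have "\<exists>\<psi>\<in>{\<psi> :: ('a, 'i) kform. kmd \<psi> \<le> Ord \<beta>}. \<exists>\<phi>\<in>{Box \<psi>, Dia \<psi>}. psat T \<phi> p \<and> \<not> psat T \<phi> q"
    using less.IH[OF \<beta>(1)]
    by (intro ex_modal_distinguishing[where emb = emb and R = "approx T \<beta>"
          and P = "{\<phi>. pmd \<phi> \<le> Ord \<beta>}"])
      (use inj \<beta>(2) in \<open>auto simp: md_conj_disj depth_sup_le_iff simp del: pmd.simps(1) kmd.simps(2)\<close>)
  then obtain \<psi> :: "('a, 'i) kform" and \<phi>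
    where \<phi>: "kmd \<psi> \<le> Ord \<beta>" "\<phi> = Box \<psi> \<or> \<phi> = Dia \<psi>" "psat T \<phi> p" "\<not> psat T \<phi> q"
    by blast
  have "Ord \<beta> < Ord \<alpha>"
    using \<beta>(1) by (simp add: less_depth_def)
  with \<phi> have "pmd \<phi> \<le> Ord \<alpha>"
    by (auto simp: depth_suc_le_Ord_iff)
  with \<phi> show ?case
    by blast
qed

text \<open>Coinduction: inclusion of theories is itself a prebisimulation, since a violated clause
  would yield a modal formula separating the two processes.\<close>

lemma prebisimilarity_complete:
  fixes T :: "('p, 'a) transition_system" and emb :: "'a \<times> 'p \<Rightarrow> 'i"
  assumes inj: "inj emb" and "(theory_of T p :: ('a, 'i) pform set) \<subseteq> theory_of T q"
  shows "(p, q) \<in> prebisimilarity T"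
proof -
  define R where "R = {(p, q). (theory_of T p :: ('a, 'i) pform set) \<subseteq> theory_of T q}"
  have "(p, q) \<in> prebisim_step T R" if "(p, q) \<in> R" for p q
  proof (rule ccontr)
    assume "(p, q) \<notin> prebisim_step T R"
    then have "\<exists>\<psi>\<in>UNIV. \<exists>\<phi>\<in>{Box \<psi>, Dia \<psi> :: ('a, 'i) pform}. psat T \<phi> p \<and> \<not> psat T \<phi> q"
      by (intro ex_modal_distinguishing[where emb = emb and P = UNIV and R = R])
        (use inj in \<open>auto simp: R_def theory_of_def\<close>)
    with that show False
      unfolding R_def theory_of_def by blast
  qed
  then have "prebisimulation T R"
    by (auto simp: prebisimulation_def)
  moreover have "(p, q) \<in> R"
    using assms by (simp add: R_def)
  ultimately show ?thesis
    by (auto simp: prebisimilarity_def)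
qed

theorem mainTheorem2:
  fixes T :: "('p, 'a) transition_system"
    and emb :: "'a \<times> 'p \<Rightarrow> 'i"
    and p q :: 'p
    and \<alpha> :: "'o::wellorder"
  assumes "inj emb"
  shows "((p, q) \<in> approx T \<alpha> \<longleftrightarrow>
            (theory_upto T UNIV \<alpha> p :: ('a, 'i) pform set) \<subseteq> theory_upto T UNIV \<alpha> q)
       \<and> ((p, q) \<in> prebisimilarity T \<longleftrightarrow>
            (theory_of T p :: ('a, 'i) pform set) \<subseteq> theory_of T q)"
proof (intro conjI iffI)
  show "(theory_upto T UNIV \<alpha> p :: ('a, 'i) pform set) \<subseteq> theory_upto T UNIV \<alpha> q"
    if "(p, q) \<in> approx T \<alpha>"
    using psat_approx(1)[OF that] by (auto simp: theory_upto_def theory_of_def)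
  show "(p, q) \<in> approx T \<alpha>"
    if "(theory_upto T UNIV \<alpha> p :: ('a, 'i) pform set) \<subseteq> theory_upto T UNIV \<alpha> q"
    using approx_complete[OF assms, of p q T \<alpha>] that
    by (auto simp: theory_upto_def theory_of_def)
  show "(theory_of T p :: ('a, 'i) pform set) \<subseteq> theory_of T q" if "(p, q) \<in> prebisimilarity T"
    using psat_prebisimilarity(1)[OF that] by (auto simp: theory_of_def)
  show "(p, q) \<in> prebisimilarity T" if "(theory_of T p :: ('a, 'i) pform set) \<subseteq> theory_of T q"
    using prebisimilarity_complete[OF assms that] .
qed

end
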